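(* Let $\mathcal G$ be a Petri game with one environment player whose underlying net is concurrency preserving. Then every unfolded global strategy $\sigma$ for the system players in $\mathcal G$ is distributable, i.e. $\sigma$ can be represented as the parallel composition of unfolded local controllers for the environment player and the system players, in the sense that the reachable part of the parallel composition is isomorphic to $\sigma$.
   Context: **Petri nets.** A (place/transition) net $\mathcal N=(\mathcal P,\mathcal T,\mathcal F,\mathit{In})$ consists of disjoint, possibly infinite sets $\mathcal P$ of places and $\mathcal T$ of transitions, a multiset $\mathcal F$ over $(\mathcal P\times\mathcal T)\cup(\mathcal T\times\mathcal P)$ (flow), and an initial marking $\mathit{In}$; a marking is a finite multiset over $\mathcal P$. $\mathit{pre}(y)(x)=\mathcal F(x,y)$ and $\mathit{post}(x)(y)=\mathcal F(x,y)$ define multisets; for each transition $t$, $\mathit{pre}(t)$ and $\mathit{post}(t)$ are finite and non-empty. $t$ is enabled at $M$ if $\mathit{pre}(t)\subseteq M$; firing it gives $M-\mathit{pre}(t)+\mathit{post}(t)$. $\mathcal R(\mathcal N)$ is the set of markings reachable from $\mathit{In}$. $\mathcal N$ is safe if $M(p)\le 1$ for all $M\in\mathcal R(\mathcal N)$, $p\in\mathcal P$. $\mathcal N$ is concurrency preserving if $|\mathit{pre}(t)|=|\mathit{post}(t)|$ for every $t\in\mathcal T$. A homomorphism $h:\mathcal N_1\to\mathcal N_2$ maps places to places and transitions to transitions with $h[\mathit{pre}(t)]=\mathit{pre}(h(t))$ and $h[\mathit{post}(t)]=\mathit{post}(h(t))$ (images of multisets) for all $t\in\mathcal T_1$; it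 is initial if $h[\mathit{In}_1]=\mathit{In}_2$. A weak homomorphism is defined in the same way with the two equalities replaced by multiset inclusions $\subseteq$. An isomorphism is a bijective initial homomorphism; labelled nets are isomorphic if there is an isomorphism preserving labels. $\mathcal N_1$ is an (initial) subnet of $\mathcal N_2$ if $\mathcal P_1\subseteq\mathcal P_2$, $\mathcal T_1\subseteq\mathcal T_2$, $\mathcal F_1\subseteq\mathcal F_2$, $\mathit{In}_1=\mathit{In}_2$. **Unfolding.** Nodes $x,y$ are in conflict if there is a place $p\ne x,y$ from which $x$ and $y$ can be reached along $\mathcal F^+$ leaving $p$ by different arcs. An occurrence net is a net where all $\mathit{pre}(t),\mathit{post}(t)$ are sets, $|\mathit{pre}(p)|\le 1$ for every place $p$, $\mathcal F^{-1}$ is well-founded, no transition is in conflict with itself, and $\mathit{In}$ is the set of places with empty precondition. Two nodes are concurrent if they are neither related by $\mathcal F^*$ nor in conflict. A branching process of $\mathcal N$ is a pair $(\mathcal N',\lambda)$ of an occurrence net $\mathcal N'$ and a homomorphism $\lambda:\mathcal N'\to\mathcal N$ such that $\mathit{pre}(t_1)=\mathit{pre}(t_2)$ and $\lambda(t_1)=\lambda(t_2)$ imply $t_1=t_2$; it is initial if $\lambda$ is. The unfolding $\beta_U=(\mathcal N^U,\lambda)$ of $\mathcal N$ is the (unique up to isomorphism) initial branching process such that for every $t\in\mathcal T$ and every set $C\subseteq\mathcal P^U$ of pairwise concurrent places with $\lambda[C]=\mathit{pre}(t)$ there is $t^U\in\mathcal T^U$ with $\mathit{pre}(t^U)=C$,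 $\lambda(t^U)=t$. A subprocess of $\beta_U$ is an initial branching process $(\mathcal N_1,\lambda_1)$ with $\mathcal N_1$ an initial subnet of $\mathcal N^U$, $\lambda_1$ the restriction of $\lambda$, and such that the inclusion is a homomorphism. **Petri games.** A Petri game is $\mathcal G=(\mathcal P_S,\mathcal P_E,\mathcal T,\mathcal F,\mathit{In},\mathcal B)$ with underlying net $\mathcal N=(\mathcal P,\mathcal T,\mathcal F,\mathit{In})$, where $\mathcal P=\mathcal P_S\cup\mathcal P_E$ is a disjoint union of system and environment places and $\mathcal B\subseteq\mathcal P$ is the set of bad places. Tokens are players; a token on a place of $\mathcal P_S$ (resp. $\mathcal P_E$) is a system (resp. environment) player. One environment player means: every reachable marking has exactly one token on $\mathcal P_E$. **Strategies.** An unfolded (global) strategy for the system players is a subprocess $\sigma=(\mathcal N^\sigma,\lambda^\sigma)$ of $\beta_U$ such that for every $p\in\mathcal P^\sigma$: (S1) if $\lambda(p)\in\mathcal P_S$, then for every $M\in\mathcal R(\mathcal N^\sigma)$ with $p\in M$ there is at most one $t\in\mathcal T^\sigma$ with $p\in\mathit{pre}(t)\subseteq M$; (S2) if $\lambda(p)\in\mathcal P_E$, then every $t\in\mathcal T^U$ with $\mathit{pre}(t)=\{p\}$ belongs to $\mathcal N^\sigma$ (with the arc $(p,t)$). **Local controllers and distribution.** A local controller is a pair $\mathcal C=(\mathcal N^C,h^C)$ of a safe net $\mathcal N^C$ with $|\mathit{In}^C|=1$ and $|\mathit{pre}^C(t)|=|\mathit{post}^C(t)|=1$ for all $t\in\mathcal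 T^C$, and a weak homomorphism $h^C$ from $\mathcal N^C$ to the underlying net $\mathcal N$ of the game. It is a controller for the environment (resp. for a system player) if $h^C$ maps all places to $\mathcal P_E$ (resp. $\mathcal P_S$). If $(\mathcal N^{CU},\lambda^C)$ is the unfolding of $\mathcal N^C$, then $(\mathcal N^{CU},h^C\circ\lambda^C)$ is an unfolded local controller. The parallel composition $\mathcal N_1\,\|\,\mathcal N_2$ of nets with $\mathcal P_1\cap\mathcal P_2=\emptyset$ is the componentwise union $(\mathcal P_1\cup\mathcal P_2,\mathcal T_1\cup\mathcal T_2,\mathcal F_1\cup\mathcal F_2,\mathit{In}_1\cup\mathit{In}_2)$, so the nets synchronize on common transitions; for controllers, the label maps are assumed to agree on common transitions and are united. The reachable part of a net is its restriction to the places and transitions reachable from the initial marking (places marked at some reachable marking, transitions enabled at some reachable marking). *)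

theory Defs
  imports "HOL-Library.Multiset"
begin

text \<open>
  Places and transitions live in different types, hence are disjoint. As pre- and postconditions of
  transitions are finite, the flow \<open>F\<close> is given by \<open>F(p,t) = count (pre N t) p\<close> and
  \<open>F(t,p) = count (post N t) p\<close>; \<open>F\<close> itself may be infinite.
\<close>

record ('p, 't) net =
  places :: "'p set"
  transitions :: "'t set"
  pre :: "'t \<Rightarrow> 'p multiset"
  post :: "'t \<Rightarrow> 'p multiset"
  init :: "'p multiset"

text \<open>The third conjunct says that the flow is a multiset over \<open>(P \<times> T) \<union> (T \<times> P)\<close>, i.e. has no
  arcs at nodes outside the net.\<close>

definition petri_net :: "('p, 't) net \<Rightarrow> bool" where
  "petri_net N \<longleftrightarrow>
     (\<forall>t\<in>transitions N. set_mset (pre N t) \<subseteq> places N \<and> set_mset (post N t) \<subseteq> places N) \<and>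
     (\<forall>t\<in>transitions N. pre N t \<noteq> {#} \<and> post N t \<noteq> {#}) \<and>
     (\<forall>t. t \<notin> transitions N \<longrightarrow> pre N t = {#} \<and> post N t = {#}) \<and>
     set_mset (init N) \<subseteq> places N"

definition enabled :: "('p, 't) net \<Rightarrow> 'p multiset \<Rightarrow> 't \<Rightarrow> bool" where
  "enabled N M t \<longleftrightarrow> t \<in> transitions N \<and> pre N t \<subseteq># M"

inductive_set reachable :: "('p, 't) net \<Rightarrow> 'p multiset set" for N :: "('p, 't) net" where
  reachable_init: "init N \<in> reachable N"
| reachable_fire: "M \<in> reachable N \<Longrightarrow> enabled N M t \<Longrightarrow> M - pre N t + post N t \<in> reachable N"

definition safe_net :: "('p, 't) net \<Rightarrow> bool" where
  "safe_net N \<longleftrightarrow> (\<forall>M\<in>reachable N. \<forall>p\<in>places N. count M p \<le> 1)"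

definition concurrency_preserving :: "('p, 't) net \<Rightarrow> bool" where
  "concurrency_preserving N \<longleftrightarrow> (\<forall>t\<in>transitions N. size (pre N t) = size (post N t))"


type_synonym ('p, 't, 'q, 'u) net_map = "('p \<Rightarrow> 'q) \<times> ('t \<Rightarrow> 'u)"

definition maps_nodes :: "('p, 't) net \<Rightarrow> ('q, 'u) net \<Rightarrow> ('p, 't, 'q, 'u) net_map \<Rightarrow> bool" where
  "maps_nodes N1 N2 h \<longleftrightarrow>
     fst h ` places N1 \<subseteq> places N2 \<and> snd h ` transitions N1 \<subseteq> transitions N2"

definition homomorphism :: "('p, 't) net \<Rightarrow> ('q, 'u) net \<Rightarrow> ('p, 't, 'q, 'u) net_map \<Rightarrow> bool" where
  "homomorphism N1 N2 h \<longleftrightarrow> maps_nodes N1 N2 h \<and>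
     (\<forall>t\<in>transitions N1. image_mset (fst h) (pre N1 t) = pre N2 (snd h t) \<and>
                         image_mset (fst h) (post N1 t) = post N2 (snd h t))"

definition weak_homomorphism :: "('p, 't) net \<Rightarrow> ('q, 'u) net \<Rightarrow> ('p, 't, 'q, 'u) net_map \<Rightarrow> bool" where
  "weak_homomorphism N1 N2 h \<longleftrightarrow> maps_nodes N1 N2 h \<and>
     (\<forall>t\<in>transitions N1. image_mset (fst h) (pre N1 t) \<subseteq># pre N2 (snd h t) \<and>
                         image_mset (fst h) (post N1 t) \<subseteq># post N2 (snd h t))"

definition initial_map :: "('p, 't) net \<Rightarrow> ('q, 'u) net \<Rightarrow> ('p, 't, 'q, 'u) net_map \<Rightarrow> bool" where
  "initial_map N1 N2 h \<longleftrightarrow> image_mset (fst h) (init N1) = init N2"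

definition isomorphism :: "('p, 't) net \<Rightarrow> ('q, 'u) net \<Rightarrow> ('p, 't, 'q, 'u) net_map \<Rightarrow> bool" where
  "isomorphism N1 N2 h \<longleftrightarrow> homomorphism N1 N2 h \<and> initial_map N1 N2 h \<and>
     bij_betw (fst h) (places N1) (places N2) \<and>
     bij_betw (snd h) (transitions N1) (transitions N2)"

definition initial_subnet :: "('p, 't) net \<Rightarrow> ('p, 't) net \<Rightarrow> bool" where
  "initial_subnet N1 N2 \<longleftrightarrow>
     places N1 \<subseteq> places N2 \<and> transitions N1 \<subseteq> transitions N2 \<and>
     (\<forall>t. pre N1 t \<subseteq># pre N2 t \<and> post N1 t \<subseteq># post N2 t) \<and> init N1 = init N2"


text \<open>A net \<open>(N, \<lambda>)\<close> with places of type \<open>'p\<close> and transitions of type \<open>'t\<close>, labelled by places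
  of type \<open>'q\<close> and transitions of type \<open>'u\<close>.\<close>

type_synonym ('p, 't, 'q, 'u) labelled_net = "('p, 't) net \<times> ('p, 't, 'q, 'u) net_map"

abbreviation place_label :: "('p, 't, 'q, 'u) labelled_net \<Rightarrow> 'p \<Rightarrow> 'q" where
  "place_label B \<equiv> fst (snd B)"

abbreviation transition_label :: "('p, 't, 'q, 'u) labelled_net \<Rightarrow> 't \<Rightarrow> 'u" where
  "transition_label B \<equiv> snd (snd B)"

definition isomorphic_labelled ::
    "('p1, 't1, 'q, 'u) labelled_net \<Rightarrow> ('p2, 't2, 'q, 'u) labelled_net \<Rightarrow> bool" where
  "isomorphic_labelled B1 B2 \<longleftrightarrow> (\<exists>h. isomorphism (fst B1) (fst B2) h \<and>
     (\<forall>p\<in>places (fst B1). place_label B2 (fst h p) = place_label B1 p) \<and>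
     (\<forall>t\<in>transitions (fst B1). transition_label B2 (snd h t) = transition_label B1 t))"


definition arcs :: "('p, 't) net \<Rightarrow> (('p + 't) \<times> ('p + 't)) set" where
  "arcs N = {(Inl p, Inr t) | p t. t \<in> transitions N \<and> p \<in># pre N t} \<union>
            {(Inr t, Inl p) | p t. t \<in> transitions N \<and> p \<in># post N t}"

text \<open>Different arcs leaving \<open>p\<close> are arcs to different transitions; parallel arcs are excluded in
  occurrence nets, where alone the notion is used.\<close>

definition conflict :: "('p, 't) net \<Rightarrow> 'p + 't \<Rightarrow> 'p + 't \<Rightarrow> bool" where
  "conflict N x y \<longleftrightarrow> (\<exists>p\<in>places N. \<exists>t1 t2. Inl p \<noteq> x \<and> Inl p \<noteq> y \<and> t1 \<noteq> t2 \<and>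
     (Inl p, Inr t1) \<in> arcs N \<and> (Inr t1, x) \<in> (arcs N)\<^sup>* \<and>
     (Inl p, Inr t2) \<in> arcs N \<and> (Inr t2, y) \<in> (arcs N)\<^sup>*)"

definition concurrent :: "('p, 't) net \<Rightarrow> 'p + 't \<Rightarrow> 'p + 't \<Rightarrow> bool" where
  "concurrent N x y \<longleftrightarrow> (x, y) \<notin> (arcs N)\<^sup>* \<and> (y, x) \<notin> (arcs N)\<^sup>* \<and> \<not> conflict N x y"

text \<open>
  The second conjunct makes pre- and postconditions sets, so \<open>|pre(p)| \<le> 1\<close> amounts to
  \<open>p\<close> having at most one input transition. \<open>wf\<close> forbids infinite chains that run against the
  relation, so \<open>wf (arcs N)\<close> is well-foundedness of the inverse flow.
\<close>

definition occurrence_net :: "('p, 't) net \<Rightarrow> bool" where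
  "occurrence_net N \<longleftrightarrow> petri_net N \<and>
     (\<forall>t\<in>transitions N. \<forall>p. count (pre N t) p \<le> 1 \<and> count (post N t) p \<le> 1) \<and>
     (\<forall>p\<in>places N. \<forall>t1\<in>transitions N. \<forall>t2\<in>transitions N.
        p \<in># post N t1 \<and> p \<in># post N t2 \<longrightarrow> t1 = t2) \<and>
     wf (arcs N) \<and>
     (\<forall>t\<in>transitions N. \<not> conflict N (Inr t) (Inr t)) \<and>
     (\<forall>p\<in>places N. count (init N) p = (if \<exists>t\<in>transitions N. p \<in># post N t then 0 else 1))"

definition branching_process :: "('q, 'u) net \<Rightarrow> ('p, 't, 'q, 'u) labelled_net \<Rightarrow> bool" where
  "branching_process N B \<longleftrightarrow> occurrence_net (fst B) \<and> homomorphism (fst B) N (snd B) \<and>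
     (\<forall>t1\<in>transitions (fst B). \<forall>t2\<in>transitions (fst B).
        pre (fst B) t1 = pre (fst B) t2 \<and> transition_label B t1 = transition_label B t2 \<longrightarrow> t1 = t2)"

definition initial_branching_process :: "('q, 'u) net \<Rightarrow> ('p, 't, 'q, 'u) labelled_net \<Rightarrow> bool" where
  "initial_branching_process N B \<longleftrightarrow> branching_process N B \<and> initial_map (fst B) N (snd B)"

text \<open>The unfolding is determined only up to isomorphism, so it is a property of a labelled net.\<close>

definition unfolding_of :: "('q, 'u) net \<Rightarrow> ('p, 't, 'q, 'u) labelled_net \<Rightarrow> bool" where
  "unfolding_of N U \<longleftrightarrow> initial_branching_process N U \<and>
     (\<forall>t\<in>transitions N. \<forall>C. C \<subseteq> places (fst U) \<and> finite C \<and>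
        (\<forall>p\<in>C. \<forall>q\<in>C. p \<noteq> q \<longrightarrow> concurrent (fst U) (Inl p) (Inl q)) \<and>
        image_mset (place_label U) (mset_set C) = pre N t \<longrightarrow>
        (\<exists>t'\<in>transitions (fst U). pre (fst U) t' = mset_set C \<and> transition_label U t' = t))"

definition subprocess ::
    "('q, 'u) net \<Rightarrow> ('p, 't, 'q, 'u) labelled_net \<Rightarrow> ('p, 't, 'q, 'u) labelled_net \<Rightarrow> bool" where
  "subprocess N U B \<longleftrightarrow> initial_branching_process N B \<and> initial_subnet (fst B) (fst U) \<and>
     (\<forall>p\<in>places (fst B). place_label B p = place_label U p) \<and>
     (\<forall>t\<in>transitions (fst B). transition_label B t = transition_label U t) \<and>
     homomorphism (fst B) (fst U) (id, id)"


record ('p, 't) game =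
  underlying :: "('p, 't) net"
  system_places :: "'p set"
  environment_places :: "'p set"
  bad_places :: "'p set"

definition petri_game :: "('p, 't) game \<Rightarrow> bool" where
  "petri_game G \<longleftrightarrow> petri_net (underlying G) \<and>
     places (underlying G) = system_places G \<union> environment_places G \<and>
     system_places G \<inter> environment_places G = {} \<and>
     bad_places G \<subseteq> places (underlying G)"

definition one_environment_player :: "('p, 't) game \<Rightarrow> bool" where
  "one_environment_player G \<longleftrightarrow>
     (\<forall>M\<in>reachable (underlying G). size {#p \<in># M. p \<in> environment_places G#} = 1)"

definition unfolded_strategy ::
    "('q, 'u) game \<Rightarrow> ('p, 't, 'q, 'u) labelled_net \<Rightarrow> ('p, 't, 'q, 'u) labelled_net \<Rightarrow> bool" where
  "unfolded_strategy G U \<sigma> \<longleftrightarrow> subprocess (underlying G) U \<sigma> \<and>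
     (\<forall>p\<in>places (fst \<sigma>).
        (place_label \<sigma> p \<in> system_places G \<longrightarrow>
          (\<forall>M\<in>reachable (fst \<sigma>). p \<in># M \<longrightarrow>
            (\<forall>t1\<in>transitions (fst \<sigma>). \<forall>t2\<in>transitions (fst \<sigma>).
              p \<in># pre (fst \<sigma>) t1 \<and> pre (fst \<sigma>) t1 \<subseteq># M \<and>
              p \<in># pre (fst \<sigma>) t2 \<and> pre (fst \<sigma>) t2 \<subseteq># M \<longrightarrow> t1 = t2))) \<and>
        (place_label \<sigma> p \<in> environment_places G \<longrightarrow>
          (\<forall>t\<in>transitions (fst U). pre (fst U) t = {#p#} \<longrightarrow>
            t \<in> transitions (fst \<sigma>) \<and> p \<in># pre (fst \<sigma>) t)))"


definition local_controller :: "('q, 'u) game \<Rightarrow> ('p, 't, 'q, 'u) labelled_net \<Rightarrow> bool" where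
  "local_controller G C \<longleftrightarrow> petri_net (fst C) \<and> safe_net (fst C) \<and> size (init (fst C)) = 1 \<and>
     (\<forall>t\<in>transitions (fst C). size (pre (fst C) t) = 1 \<and> size (post (fst C) t) = 1) \<and>
     weak_homomorphism (fst C) (underlying G) (snd C)"

definition environment_controller :: "('q, 'u) game \<Rightarrow> ('p, 't, 'q, 'u) labelled_net \<Rightarrow> bool" where
  "environment_controller G C \<longleftrightarrow>
     local_controller G C \<and> place_label C ` places (fst C) \<subseteq> environment_places G"

definition system_controller :: "('q, 'u) game \<Rightarrow> ('p, 't, 'q, 'u) labelled_net \<Rightarrow> bool" where
  "system_controller G C \<longleftrightarrow>
     local_controller G C \<and> place_label C ` places (fst C) \<subseteq> system_places G"

definition unfolded_controller_of ::
    "('r, 'v, 'q, 'u) labelled_net \<Rightarrow> ('p, 't, 'q, 'u) labelled_net \<Rightarrow> bool" where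
  "unfolded_controller_of C K \<longleftrightarrow> (\<exists>l :: ('p, 't, 'r, 'v) net_map.
     unfolding_of (fst C) (fst K, l) \<and> snd K = (place_label C \<circ> fst l, transition_label C \<circ> snd l))"


definition composable ::
    "('p, 't, 'q, 'u) labelled_net \<Rightarrow> ('p, 't, 'q, 'u) labelled_net \<Rightarrow> bool" where
  "composable K1 K2 \<longleftrightarrow> places (fst K1) \<inter> places (fst K2) = {} \<and>
     (\<forall>t\<in>transitions (fst K1) \<inter> transitions (fst K2).
        transition_label K1 t = transition_label K2 t)"

definition par_net :: "('p, 't) net \<Rightarrow> ('p, 't) net \<Rightarrow> ('p, 't) net" where
  "par_net N1 N2 =
     \<lparr>places = places N1 \<union> places N2,
      transitions = transitions N1 \<union> transitions N2,
      pre = (\<lambda>t. pre N1 t \<union># pre N2 t),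
      post = (\<lambda>t. post N1 t \<union># post N2 t),
      init = init N1 \<union># init N2\<rparr>"

definition par :: "('p, 't, 'q, 'u) labelled_net \<Rightarrow> ('p, 't, 'q, 'u) labelled_net \<Rightarrow>
    ('p, 't, 'q, 'u) labelled_net" where
  "par K1 K2 = (par_net (fst K1) (fst K2),
     (\<lambda>p. if p \<in> places (fst K1) then place_label K1 p else place_label K2 p),
     (\<lambda>t. if t \<in> transitions (fst K1) then transition_label K1 t else transition_label K2 t))"

definition restrict_net :: "'p set \<Rightarrow> 't set \<Rightarrow> ('p, 't) net \<Rightarrow> ('p, 't) net" where
  "restrict_net P T N =
     \<lparr>places = places N \<inter> P,
      transitions = transitions N \<inter> T,
      pre = (\<lambda>t. if t \<in> T then {#p \<in># pre N t. p \<in> P#} else {#}),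
      post = (\<lambda>t. if t \<in> T then {#p \<in># post N t. p \<in> P#} else {#}),
      init = {#p \<in># init N. p \<in> P#}\<rparr>"

definition reachable_part :: "('p, 't) net \<Rightarrow> ('p, 't) net" where
  "reachable_part N = restrict_net {p. \<exists>M\<in>reachable N. p \<in># M} {t. \<exists>M\<in>reachable N. enabled N M t} N"

text \<open>
  Composed are one controller \<open>E\<close> for the environment player and a list \<open>Ss\<close> of controllers for
  the system players; since every controller starts with one token, the isomorphism forces one
  controller per token of the initial marking. \<open>sorted_wrt composable\<close> says that any two of them
  are composable.

  HOL cannot quantify over node types, so the controllers, before and after unfolding, have the node
  types of the strategy. For a given unfolded controller this loses no generality, as it is itself
  a local controller and its own unfolding; for the existence claim, fixing the types makes the
  notion no weaker.
\<close>

definition distributable :: "('q, 'u) game \<Rightarrow> ('p, 't, 'q, 'u) labelled_net \<Rightarrow> bool" where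
  "distributable G \<sigma> \<longleftrightarrow> (\<exists>E Ss :: ('p, 't, 'q, 'u) labelled_net list.
     (\<exists>C :: ('p, 't, 'q, 'u) labelled_net. environment_controller G C \<and> unfolded_controller_of C E) \<and>
     (\<forall>S\<in>set Ss. \<exists>C :: ('p, 't, 'q, 'u) labelled_net.
        system_controller G C \<and> unfolded_controller_of C S) \<and>
     sorted_wrt composable (E # Ss) \<and>
     (let K = foldl par E Ss in isomorphic_labelled (reachable_part (fst K), snd K) \<sigma>))"

end

theory Submission
  imports Defs
begin

text \<open>
  In a concurrency preserving net with one environment player every transition of the strategy
  consumes as many environment and as many system tokens as it produces: it fires at some reachable
  marking, and the environment tokens are counted before and after. So one can choose, for every
  transition, a bijection between the tokens produced and the tokens consumed that respects the
  owners. Following these bijections backwards traces every place of the strategy to a token of the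
  initial marking. The places traced to the same token form a slice, in which every reachable marking
  has exactly one token; hence a transition touching a slice has one place of it before and one
  after. Each slice is an occurrence net, hence its own unfolding, and the parallel composition of
  all the slices is the strategy itself.
\<close>

section \<open>Multisets, firing under homomorphisms, and bijections\<close>

lemma mset_set_set_mset_le_1:
  assumes "\<And>x. count M x \<le> 1"
  shows "mset_set (set_mset M) = M"
proof (rule multiset_eqI)
  fix x
  show "count (mset_set (set_mset M)) x = count M x"
    using assms[of x] by (cases "x \<in># M") (auto simp: count_mset_set' not_in_iff
        simp flip: count_greater_zero_iff)
qed

text \<open>The additive form avoids truncated subtraction. It serves to count environment tokens,
  tokens in a slice, and all tokens across a firing.\<close>

lemma size_filter_fire:
  assumes "A \<subseteq># M"
  shows "size {#x \<in># M - A + B. P x#} + size {#x \<in># A. P x#} =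
    size {#x \<in># M. P x#} + size {#x \<in># B. P x#}"
proof -
  obtain C where "M = A + C"
    using assms by (metis subset_mset.add_diff_inverse)
  then show ?thesis
    by simp
qed

text \<open>Images of firing sequences are firing sequences. This carries the condition of one
  environment player from the game over to the strategy.\<close>

lemma reachable_image_homomorphism:
  assumes "homomorphism N1 N2 h" "initial_map N1 N2 h" "M \<in> reachable N1"
  shows "image_mset (fst h) M \<in> reachable N2"
  using assms(3)
proof induction
  case reachable_init
  then show ?case
    using assms(2) reachable.reachable_init[of N2] by (simp add: initial_map_def)
next
  case (reachable_fire M t)
  then have t: "t \<in> transitions N1" "pre N1 t \<subseteq># M"
    by (auto simp: enabled_def)
  with assms(1) have h: "snd h t \<in> transitions N2"
    "image_mset (fst h) (pre N1 t) = pre N2 (snd h t)"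
    "image_mset (fst h) (post N1 t) = post N2 (snd h t)"
    by (auto simp: homomorphism_def maps_nodes_def)
  moreover have "image_mset (fst h) (pre N1 t) \<subseteq># image_mset (fst h) M"
    using t by (simp add: image_mset_subseteq_mono)
  ultimately have "enabled N2 (image_mset (fst h) M) (snd h t)"
    by (simp add: enabled_def)
  then show ?case
    using reachable.reachable_fire[OF reachable_fire.IH]
    unfolding image_mset_union image_mset_Diff[OF t(2)] h by blast
qed

text \<open>Equal totals leave equally many elements outside \<open>P\<close>, so bijections between
  the two parts exist and can be glued.\<close>

lemma exists_bij_betw_respecting:
  assumes "finite A" "finite B"
    and "card {x \<in> A. P x} = card {x \<in> B. P x}" "card A = card B"
  shows "\<exists>f. bij_betw f A B \<and> (\<forall>x\<in>A. P (f x) \<longleftrightarrow> P x)"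
proof -
  have split: "card {x \<in> S. P x} + card {x \<in> S. \<not> P x} = card S" if "finite S" for S
    using that by (subst card_Un_disjoint[symmetric]) (auto intro: arg_cong[where f = card])
  have "card {x \<in> A. \<not> P x} = card {x \<in> B. \<not> P x}"
    using split[OF assms(1)] split[OF assms(2)] assms(3,4) by simp
  then obtain f g where f: "bij_betw f {x \<in> A. P x} {x \<in> B. P x}"
    and g: "bij_betw g {x \<in> A. \<not> P x} {x \<in> B. \<not> P x}"
    using assms finite_same_card_bij[of "{x \<in> A. P x}" "{x \<in> B. P x}"]
      finite_same_card_bij[of "{x \<in> A. \<not> P x}" "{x \<in> B. \<not> P x}"] by auto
  let ?h = "\<lambda>x. if P x then f x else g x"
  have "bij_betw ?h {x \<in> A. P x} {x \<in> B. P x} \<longleftrightarrow> bij_betw f {x \<in> A. P x} {x \<in> B. P x}"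
    by (rule bij_betw_cong) auto
  moreover have "bij_betw ?h {x \<in> A. \<not> P x} {x \<in> B. \<not> P x} \<longleftrightarrow>
      bij_betw g {x \<in> A. \<not> P x} {x \<in> B. \<not> P x}"
    by (rule bij_betw_cong) auto
  ultimately have h: "bij_betw ?h {x \<in> A. P x} {x \<in> B. P x}"
    "bij_betw ?h {x \<in> A. \<not> P x} {x \<in> B. \<not> P x}"
    using f g by blast+
  have "bij_betw ?h ({x \<in> A. P x} \<union> {x \<in> A. \<not> P x}) ({x \<in> B. P x} \<union> {x \<in> B. \<not> P x})"
    by (rule bij_betw_combine[OF h]) auto
  moreover have "{x \<in> S. P x} \<union> {x \<in> S. \<not> P x} = S" for S
    by auto
  moreover have "\<forall>x\<in>A. P (?h x) \<longleftrightarrow> P x"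
    using bij_betwE[OF f] bij_betwE[OF g] by auto
  ultimately show ?thesis
    by auto
qed

section \<open>Firability in occurrence nets\<close>

locale occ_net =
  fixes N :: "('p, 't) net"
  assumes occurrence_net: "occurrence_net N"
begin

section \<open>Elementary facts on occurrence nets\<close>

lemma petri_net: "petri_net N"
  using occurrence_net by (simp add: occurrence_net_def)

text \<open>Transitions outside the net have no arcs, so an arc alone certifies membership.\<close>

lemma pre_transition: "p \<in># pre N t \<Longrightarrow> t \<in> transitions N"
  and post_transition: "p \<in># post N t \<Longrightarrow> t \<in> transitions N"
  using petri_net unfolding petri_net_def by fastforce+

lemma pre_places: "p \<in># pre N t \<Longrightarrow> p \<in> places N"
  and post_places: "p \<in># post N t \<Longrightarrow> p \<in> places N"
  and init_places: "p \<in># init N \<Longrightarrow> p \<in> places N"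
  using petri_net pre_transition post_transition unfolding petri_net_def by blast+

lemma pre_nonempty: "t \<in> transitions N \<Longrightarrow> pre N t \<noteq> {#}"
  using petri_net by (simp add: petri_net_def)

lemma pre_count_le_1: "count (pre N t) p \<le> 1"
  and post_count_le_1: "count (post N t) p \<le> 1"
  using occurrence_net petri_net unfolding occurrence_net_def petri_net_def
  by (cases "t \<in> transitions N"; simp)+

lemma init_count: "p \<in> places N \<Longrightarrow> count (init N) p = (if \<exists>t. p \<in># post N t then 0 else 1)"
  using occurrence_net post_transition unfolding occurrence_net_def by (auto split: if_splits)

lemma in_init_iff: "p \<in> places N \<Longrightarrow> p \<in># init N \<longleftrightarrow> (\<nexists>t. p \<in># post N t)"
  using init_count[of p] by (simp flip: count_greater_zero_iff)

lemma init_count_le_1: "count (init N) p \<le> 1"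
  using init_count[of p] init_places[of p] by (cases "p \<in># init N") (auto simp: not_in_iff)

lemma mset_pre [simp]: "mset_set (set_mset (pre N t)) = pre N t"
  and mset_post [simp]: "mset_set (set_mset (post N t)) = post N t"
  and mset_init [simp]: "mset_set (set_mset (init N)) = init N"
  by (rule mset_set_set_mset_le_1; rule pre_count_le_1 post_count_le_1 init_count_le_1)+

lemma size_filter_pre: "size {#p \<in># pre N t. P p#} = card {p \<in> set_mset (pre N t). P p}"
  and size_filter_post: "size {#p \<in># post N t. P p#} = card {p \<in> set_mset (post N t). P p}"
  by (metis filter_mset_mset_set finite_set_mset mset_pre size_mset_set)
    (metis filter_mset_mset_set finite_set_mset mset_post size_mset_set)

lemma producer_unique: "p \<in># post N t1 \<Longrightarrow> p \<in># post N t2 \<Longrightarrow> t1 = t2"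
  using occurrence_net post_transition post_places unfolding occurrence_net_def by blast

lemma arcs_iff [simp]:
  "(Inl p, Inr t) \<in> arcs N \<longleftrightarrow> p \<in># pre N t"
  "(Inr t, Inl p) \<in> arcs N \<longleftrightarrow> p \<in># post N t"
  using pre_transition post_transition by (auto simp: arcs_def)

lemma wf_arcs: "wf (arcs N)"
  using occurrence_net by (simp add: occurrence_net_def)

lemma no_self_conflict: "t \<in> transitions N \<Longrightarrow> \<not> conflict N (Inr t) (Inr t)"
  using occurrence_net by (simp add: occurrence_net_def)

section \<open>Causality, configurations and cuts\<close>

definition causes :: "('t \<times> 't) set" where
  "causes = {(t, t'). \<exists>p. p \<in># post N t \<and> p \<in># pre N t'}"

lemma causes_arcs: "(t, t') \<in> causes \<Longrightarrow> (Inr t, Inr t') \<in> (arcs N)\<^sup>+"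
  unfolding causes_def using arcs_iff by (blast intro: trancl_into_trancl r_into_trancl)

lemma causes_rtrancl_arcs: "(t, t') \<in> causes\<^sup>* \<Longrightarrow> (Inr t, Inr t') \<in> (arcs N)\<^sup>*"
  by (induction rule: rtrancl_induct) (auto dest!: causes_arcs intro: rtrancl_trans trancl_into_rtrancl)

lemma wf_causes: "wf causes"
proof -
  have "causes \<subseteq> inv_image ((arcs N)\<^sup>+) Inr"
    using causes_arcs by (auto simp: inv_image_def)
  then show ?thesis
    by (rule wf_subset[OF wf_inv_image[OF wf_trancl[OF wf_arcs]]])
qed

text \<open>A transition has finitely many direct causes, since it has finitely many input places
  and each of these has at most one producer. Well-founded induction extends this to all
  causes.\<close>

lemma finite_past: "finite {t'. (t', t) \<in> causes\<^sup>*}"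
proof (induction t rule: wf_induct_rule[OF wf_causes])
  case (1 t)
  have "{t'. (t', t) \<in> causes} = (\<Union>p\<in>set_mset (pre N t). {t'. p \<in># post N t'})"
    by (auto simp: causes_def)
  moreover have "finite {t'. p \<in># post N t'}" for p
  proof (rule finite_subset)
    \<comment> \<open>If \<open>p\<close> has no producer, the choice is arbitrary but the left side
      is empty.\<close>
    show "{t'. p \<in># post N t'} \<subseteq> {SOME t'. p \<in># post N t'}"
      using producer_unique by (auto intro: someI2)
  qed simp
  ultimately have "finite {t'. (t', t) \<in> causes}"
    by simp
  moreover have "{t'. (t', t) \<in> causes\<^sup>*} =
      insert t (\<Union>t''\<in>{t''. (t'', t) \<in> causes}. {t'. (t', t'') \<in> causes\<^sup>*})"
    by (auto elim: rtranclE intro: rtrancl_into_rtrancl)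
  ultimately show ?case
    using 1 by auto
qed

text \<open>Finite configurations in the usual sense. The last conjunct excludes only direct
  conflict; together with causal closure it excludes inherited conflict too.\<close>

definition configuration :: "'t set \<Rightarrow> bool" where
  "configuration C \<longleftrightarrow> finite C \<and> C \<subseteq> transitions N \<and>
     (\<forall>t\<in>C. \<forall>t'. (t', t) \<in> causes \<longrightarrow> t' \<in> C) \<and>
     (\<forall>t1\<in>C. \<forall>t2\<in>C. \<forall>p. p \<in># pre N t1 \<and> p \<in># pre N t2 \<longrightarrow> t1 = t2)"

text \<open>For a configuration \<open>C\<close>, the places marked after each transition of
  \<open>C\<close> has fired once.\<close>

definition cut :: "'t set \<Rightarrow> 'p set" where
  "cut C = set_mset (init N) \<union> (\<Union>t\<in>C. set_mset (post N t)) - (\<Union>t\<in>C. set_mset (pre N t))"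

lemma finite_cut: "finite C \<Longrightarrow> finite (cut C)"
  by (simp add: cut_def)

text \<open>An input place of \<open>t\<close> is initial or produced by a direct cause of
  \<open>t\<close>, which lies in \<open>C\<close> by causal closure. No transition of
  \<open>C\<close> consumes it, as it would share an input place with \<open>t\<close>.\<close>

lemma pre_subset_cut:
  assumes "configuration (insert t C)" "t \<notin> C"
  shows "set_mset (pre N t) \<subseteq> cut C"
proof
  fix p assume p: "p \<in># pre N t"
  have "p \<in># init N \<or> (\<exists>t'\<in>C. p \<in># post N t')"
  proof (cases "p \<in># init N")
    case False
    then obtain t' where t': "p \<in># post N t'"
      using in_init_iff pre_places p by blast
    then have "(t', t) \<in> causes"
      using p by (auto simp: causes_def)
    then have "t' \<in> insert t C" "t' \<noteq> t"
      using assms(1) wf_causes by (auto simp: configuration_def)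
    then show ?thesis
      using t' by auto
  qed simp
  moreover have "p \<notin># pre N t'" if "t' \<in> C" for t'
    using assms p that unfolding configuration_def by blast
  ultimately show "p \<in> cut C"
    by (auto simp: cut_def)
qed

lemma mset_cut_enabled:
  assumes "configuration (insert t C)" "t \<notin> C"
  shows "enabled N (mset_set (cut C)) t"
proof -
  have "finite C"
    using assms by (simp add: configuration_def)
  then have "mset_set (set_mset (pre N t)) \<subseteq># mset_set (cut C)"
    using pre_subset_cut[OF assms] finite_cut by (intro subset_imp_msubset_mset_set)
  then show ?thesis
    using assms by (auto simp: enabled_def configuration_def)
qed

text \<open>Induction on the size of \<open>C\<close>: remove a causally maximal transition
  \<open>t\<close>, reach the cut of the rest, and fire \<open>t\<close> there.\<close>

lemma cut_reachable: "configuration C \<Longrightarrow> mset_set (cut C) \<in> reachable N"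
proof (induction "card C" arbitrary: C)
  case 0
  then have "C = {}"
    by (simp add: configuration_def)
  then show ?case
    by (simp add: cut_def reachable_init)
next
  case (Suc n)
  \<comment> \<open>\<open>causes\<close> is well-founded only towards the past; restricting it to
    the finite set \<open>C\<close> makes the converse well-founded as well, which yields a maximal
    element.\<close>
  define R where "R = causes \<inter> C \<times> C"
  have fin: "finite C" and ne: "C \<noteq> {}"
    using Suc by (auto simp: configuration_def)
  have "acyclic R"
    using wf_acyclic[OF wf_causes] unfolding R_def by (rule acyclic_subset) simp
  then have "wf (R\<inverse>)"
    using fin by (intro finite_acyclic_wf_converse) (auto simp: R_def)
  then obtain t where t: "t \<in> C" "\<And>t'. (t', t) \<in> R\<inverse> \<Longrightarrow> t' \<notin> C"
    using ne by (meson ex_in_conv wfE_min)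
  have max: "t' \<notin> C" if "(t, t') \<in> causes" for t'
    using t that unfolding R_def by blast
  define D where "D = C - {t}"
  have C: "C = insert t D" "t \<notin> D"
    using t by (auto simp: D_def)
  have D: "configuration D"
    using Suc.prems max by (auto simp: configuration_def D_def)
  then have reach: "mset_set (cut D) \<in> reachable N"
    using Suc fin t by (auto simp: D_def)
  have conf: "configuration (insert t D)"
    using Suc.prems C by simp
  have pre: "set_mset (pre N t) \<subseteq> cut D"
    by (rule pre_subset_cut[OF conf C(2)])
  \<comment> \<open>Output places of \<open>t\<close> are fresh: by maximality nothing in
    \<open>C\<close> consumes them, and their only producer is \<open>t\<close>. Hence the set
    operations below turn into multiset operations.\<close>
  have new: "p \<notin> (\<Union>t\<in>C. set_mset (pre N t))" "p \<notin> cut D" if "p \<in># post N t" for p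
  proof -
    show "p \<notin> (\<Union>t\<in>C. set_mset (pre N t))"
      using that max by (auto simp: causes_def)
    show "p \<notin> cut D"
      using that in_init_iff[OF post_places[OF that]] producer_unique[OF that] C(2)
      unfolding cut_def by blast
  qed
  have "cut C = cut D - set_mset (pre N t) \<union> set_mset (post N t)"
    using new unfolding cut_def C(1) by auto
  moreover have "(cut D - set_mset (pre N t)) \<inter> set_mset (post N t) = {}"
    using new by auto
  moreover have "finite (cut D)"
    using D finite_cut by (simp add: configuration_def)
  ultimately have "mset_set (cut C) = mset_set (cut D) - pre N t + post N t"
    using pre by (simp add: mset_set_Union mset_set_Diff)
  then show ?case
    using reachable_fire[OF reach mset_cut_enabled[OF conf C(2)]] by simp
qed

text \<open>The causes of \<open>t\<close> other than \<open>t\<close> itself form a configuration,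
  and \<open>t\<close> is enabled at its cut.\<close>

lemma firable:
  assumes t: "t \<in> transitions N"
  shows "\<exists>M\<in>reachable N. enabled N M t"
proof -
  define D where "D = {t'. (t', t) \<in> causes\<^sup>*} - {t}"
  have ins: "insert t D = {t'. (t', t) \<in> causes\<^sup>*}"
    by (auto simp: D_def)
  have "t' \<in> transitions N" if "(t', t) \<in> causes\<^sup>*" for t'
    using that t by (cases rule: converse_rtranclE) (auto simp: causes_def intro: post_transition)
  \<comment> \<open>Two different causes of \<open>t\<close> with a common input place would put
    \<open>t\<close> in conflict with itself.\<close>
  moreover have "t1 = t2" if "(t1, t) \<in> causes\<^sup>*" "(t2, t) \<in> causes\<^sup>*" "p \<in># pre N t1" "p \<in># pre N t2"
    for t1 t2 p
    using no_self_conflict[OF t] that pre_places causes_rtrancl_arcs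
    unfolding conflict_def by (metis Inl_Inr_False arcs_iff(1))
  ultimately have conf: "configuration (insert t D)"
    unfolding configuration_def ins using finite_past[of t]
    by (auto intro: converse_rtrancl_into_rtrancl)
  \<comment> \<open>By acyclicity \<open>t\<close> is maximal in its own past, so removing it
    preserves causal closure.\<close>
  have "(t, t') \<notin> causes" if "(t', t) \<in> causes\<^sup>*" for t'
    using that wf_acyclic[OF wf_causes] by (auto simp: acyclic_def dest: rtrancl_into_trancl2)
  then have "configuration D"
    using conf unfolding configuration_def D_def
    by (auto intro: converse_rtrancl_into_rtrancl)
  then show ?thesis
    using cut_reachable mset_cut_enabled[OF conf] by (auto simp: D_def)
qed

lemma place_reachable:
  assumes "p \<in> places N"
  shows "\<exists>M\<in>reachable N. p \<in># M"
proof (cases "p \<in># init N")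
  case True
  then show ?thesis
    using reachable_init by blast
next
  case False
  then obtain t where t: "p \<in># post N t"
    using in_init_iff assms by blast
  then obtain M where "M \<in> reachable N" "enabled N M t"
    using firable post_transition by blast
  then show ?thesis
    using reachable_fire[of M N t] t by (intro bexI[of _ "M - pre N t + post N t"]) auto
qed

text \<open>Every place and transition is reachable, so the restriction drops nothing and even
  equality of nets holds.\<close>

lemma reachable_part_eq: "reachable_part N = N"
proof -
  have 1: "places N \<inter> {p. \<exists>M\<in>reachable N. p \<in># M} = places N"
    using place_reachable by auto
  have T: "(\<exists>M\<in>reachable N. enabled N M t) \<longleftrightarrow> t \<in> transitions N" for t
    using firable by (auto simp: enabled_def)
  have F: "{#p \<in># M. \<exists>M\<in>reachable N. p \<in># M#} = M" if "set_mset M \<subseteq> places N" for M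
    using that place_reachable by (subst filter_mset_eq_conv) auto
  have "pre N t = {#}" "post N t = {#}" if "t \<notin> transitions N" for t
    using petri_net that by (auto simp: petri_net_def)
  moreover have "set_mset (pre N t) \<subseteq> places N" "set_mset (post N t) \<subseteq> places N"
    "set_mset (init N) \<subseteq> places N" for t
    using pre_places post_places init_places by auto
  ultimately show ?thesis
    unfolding reachable_part_def restrict_net_def
    by (intro net.equality) (auto simp: 1 T F fun_eq_iff)
qed

end

section \<open>Slices\<close>

text \<open>The token on \<open>p \<in> post N t\<close> is viewed as the continuation of the token on \<open>origin t p\<close>.\<close>

locale traced_net = occ_net N for N :: "('p, 't) net" +
  fixes origin :: "'t \<Rightarrow> 'p \<Rightarrow> 'p"
  assumes origin: "t \<in> transitions N \<Longrightarrow>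
    bij_betw (origin t) (set_mset (post N t)) (set_mset (pre N t))"
begin

section \<open>Tracing tokens back to the initial marking\<close>

lemma origin_pre: "p \<in># post N t \<Longrightarrow> origin t p \<in># pre N t"
  using origin post_transition by (metis bij_betwE)

text \<open>All places that the token starting on \<open>r\<close> may come to occupy, over all
  branches of the net.\<close>

inductive_set slice :: "'p \<Rightarrow> 'p set" for r :: 'p where
  root: "r \<in> slice r"
| step: "p \<in># post N t \<Longrightarrow> origin t p \<in> slice r \<Longrightarrow> p \<in> slice r"

text \<open>For the forward direction: \<open>p\<close> is not the root, as initial places have no
  producer, and its only producer is \<open>t\<close>, so it entered the slice through
  \<open>origin t p\<close>.\<close>

lemma slice_post_iff:
  assumes "r \<in># init N" "p \<in># post N t"
  shows "p \<in> slice r \<longleftrightarrow> origin t p \<in> slice r"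
proof
  assume "p \<in> slice r"
  then show "origin t p \<in> slice r"
  proof cases
    case root
    then show ?thesis
      using assms in_init_iff init_places by blast
  next
    case (step t')
    then show ?thesis
      using assms producer_unique by blast
  qed
qed (use assms step in blast)

lemma init_slice_iff:
  assumes "r \<in># init N" "r' \<in># init N"
  shows "r' \<in> slice r \<longleftrightarrow> r' = r"
proof
  assume "r' \<in> slice r"
  then show "r' = r"
    using assms in_init_iff init_places by cases blast+
qed (simp add: slice.root)

lemma slice_disjoint:
  assumes "r \<in># init N" "r' \<in># init N" "r \<noteq> r'"
  shows "slice r \<inter> slice r' = {}"
proof -
  have "p \<notin> slice r'" if "p \<in> slice r" for p
    using that
  proof induction
    case root
    then show ?case
      using init_slice_iff assms by blast
  next
    case (step p t)
    then show ?case
      using slice_post_iff assms by blast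
  qed
  then show ?thesis
    by auto
qed

text \<open>Following \<open>origin\<close> backwards runs against the flow, so it stops, and it can
  stop only at an initial place.\<close>

lemma places_subset_slices: "places N \<subseteq> (\<Union>r\<in>set_mset (init N). slice r)"
proof
  fix p
  have "wf (inv_image ((arcs N)\<^sup>+) Inl)"
    using wf_arcs by (intro wf_inv_image wf_trancl)
  then show "p \<in> places N \<Longrightarrow> p \<in> (\<Union>r\<in>set_mset (init N). slice r)"
  proof (induction p rule: wf_induct_rule)
    case (less p)
    show ?case
    proof (cases "p \<in># init N")
      case True
      then show ?thesis
        using slice.root by blast
    next
      case False
      then obtain t where t: "p \<in># post N t"
        using in_init_iff less.prems by blast
      let ?q = "origin t p"
      have q: "?q \<in># pre N t"
        using origin_pre t .
      have "(Inl ?q, Inl p) \<in> (arcs N)\<^sup>+"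
        using q t by (meson arcs_iff trancl.simps)
      then have "?q \<in> (\<Union>r\<in>set_mset (init N). slice r)"
        using less.IH[of ?q] pre_places q by simp
      then show ?thesis
        using slice.step t by blast
    qed
  qed
qed

text \<open>\<open>origin t\<close> restricts to a bijection between the slice places after and
  before \<open>t\<close>.\<close>

lemma size_filter_slice:
  assumes "r \<in># init N"
  shows "size {#p \<in># post N t. p \<in> slice r#} = size {#p \<in># pre N t. p \<in> slice r#}"
proof (cases "t \<in> transitions N")
  case True
  let ?A = "{p \<in> set_mset (post N t). p \<in> slice r}"
  let ?B = "{p \<in> set_mset (pre N t). p \<in> slice r}"
  have "bij_betw (origin t) ?A ?B"
    using origin[OF True] by (rule bij_betw_Collect) (simp add: slice_post_iff assms)
  then have "card ?A = card ?B"
    by (rule bij_betw_same_card)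
  then show ?thesis
    by (simp add: size_filter_pre size_filter_post)
next
  case False
  then show ?thesis
    using petri_net by (simp add: petri_net_def)
qed

text \<open>Initially the root carries the only token of the slice, and each firing preserves the
  count.\<close>

lemma reachable_size_slice:
  assumes "r \<in># init N" "M \<in> reachable N"
  shows "size {#p \<in># M. p \<in> slice r#} = 1"
  using assms(2)
proof induction
  case reachable_init
  have "{#p \<in># init N. p \<in> slice r#} = {#p \<in># init N. p = r#}"
    by (rule filter_mset_cong) (use init_slice_iff assms(1) in auto)
  moreover have "count (init N) r = 1"
    using init_count_le_1[of r] assms(1) by (simp flip: count_greater_zero_iff)
  ultimately show ?case
    by (simp add: filter_eq_replicate_mset)
next
  case (reachable_fire M t)
  then have "pre N t \<subseteq># M"
    by (simp add: enabled_def)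
  then show ?case
    using size_filter_fire[of "pre N t" M "\<lambda>p. p \<in> slice r" "post N t"]
      reachable_fire.IH size_filter_slice[OF assms(1), of t]
    by linarith
qed

text \<open>Firability supplies a reachable marking that contains \<open>pre N t\<close>, and only
  one of its tokens lies in the slice.\<close>

lemma size_pre_slice_le_1:
  assumes "r \<in># init N"
  shows "size {#p \<in># pre N t. p \<in> slice r#} \<le> 1"
proof (cases "t \<in> transitions N")
  case True
  then obtain M where M: "M \<in> reachable N" "enabled N M t"
    using firable by blast
  then have "{#p \<in># pre N t. p \<in> slice r#} \<subseteq># {#p \<in># M. p \<in> slice r#}"
    by (simp add: enabled_def multiset_filter_mono)
  then show ?thesis
    using reachable_size_slice[OF assms M(1)] size_mset_mono by fastforce
next
  case False
  then show ?thesis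
    using petri_net by (simp add: petri_net_def)
qed

section \<open>Nets cut out by sets of places, and their composition\<close>

definition touching :: "'p set \<Rightarrow> 't set" where
  "touching A = {t. \<exists>p\<in>A. p \<in># pre N t}"

text \<open>Taking any set of places, not just one slice, covers the partial compositions as
  well.\<close>

definition slice_net :: "'p set \<Rightarrow> ('p, 't) net" where
  "slice_net A = restrict_net A (touching A) N"

text \<open>Ensures that \<open>touching A\<close>, which looks only at input places, also contains
  the producers of places in \<open>A\<close>.\<close>

definition closed :: "'p set \<Rightarrow> bool" where
  "closed A \<longleftrightarrow> (\<forall>t. \<forall>p\<in>A. p \<in># post N t \<longrightarrow> t \<in> touching A)"

lemma slice_closed: "r \<in># init N \<Longrightarrow> closed (slice r)"
  unfolding closed_def touching_def using slice_post_iff origin_pre by blast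

text \<open>Under closedness, transitions outside \<open>touching A\<close> have no arcs at
  \<open>A\<close>, so the case distinction of \<open>restrict_net\<close> disappears.\<close>

lemma slice_net_simps:
  assumes "closed A"
  shows "places (slice_net A) = places N \<inter> A"
    "transitions (slice_net A) = touching A"
    "pre (slice_net A) t = {#p \<in># pre N t. p \<in> A#}"
    "post (slice_net A) t = {#p \<in># post N t. p \<in> A#}"
    "init (slice_net A) = {#p \<in># init N. p \<in> A#}"
proof -
  show "transitions (slice_net A) = touching A"
    using pre_transition by (auto simp: slice_net_def restrict_net_def touching_def)
  have "{#p \<in># pre N t. p \<in> A#} = {#}" "{#p \<in># post N t. p \<in> A#} = {#}" if "t \<notin> touching A"
    using that assms unfolding closed_def touching_def by (auto simp: filter_mset_eq_mempty_iff)
  then show "pre (slice_net A) t = {#p \<in># pre N t. p \<in> A#}"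
    "post (slice_net A) t = {#p \<in># post N t. p \<in> A#}"
    by (auto simp: slice_net_def restrict_net_def)
qed (simp_all add: slice_net_def restrict_net_def)

text \<open>\<open>\<union>#\<close> takes the maximum of the counts, and each count is either that
  of the original multiset or zero. The common labelling \<open>l\<close> makes the case
  distinctions in \<open>par\<close> collapse.\<close>

lemma par_slice_nets:
  assumes "closed A" "closed B"
  shows "closed (A \<union> B)"
    and "par (slice_net A, l) (slice_net B, l) = (slice_net (A \<union> B), l)"
proof -
  have T: "touching (A \<union> B) = touching A \<union> touching B"
    by (auto simp: touching_def)
  show cl: "closed (A \<union> B)"
    using assms by (auto simp: closed_def T)
  have F: "{#p \<in># M. p \<in> A#} \<union># {#p \<in># M. p \<in> B#} = {#p \<in># M. p \<in> A \<or> p \<in> B#}" for M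
    by (rule multiset_eqI) simp
  have "par_net (slice_net A) (slice_net B) = slice_net (A \<union> B)"
    by (rule net.equality)
      (auto simp: par_net_def slice_net_simps assms cl T F fun_eq_iff)
  then show "par (slice_net A, l) (slice_net B, l) = (slice_net (A \<union> B), l)"
    by (simp add: par_def cong: if_cong)
qed

lemma foldl_par_slice_nets:
  assumes "closed A" "\<forall>r\<in>set rs. closed (f r)"
  shows "foldl par (slice_net A, l) (map (\<lambda>r. (slice_net (f r), l)) rs) =
    (slice_net (A \<union> (\<Union>r\<in>set rs. f r)), l)"
  using assms
proof (induction rs arbitrary: A)
  case (Cons r rs)
  then show ?case
    using Cons.IH[of "A \<union> f r"] by (simp add: par_slice_nets Un_assoc)
qed simp

text \<open>Every transition has an input place, so it touches \<open>A\<close>. Applied to the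
  union of all slices, this identifies their composition with \<open>N\<close>.\<close>

lemma slice_net_eq:
  assumes "places N \<subseteq> A"
  shows "slice_net A = N"
proof -
  have T: "touching A = transitions N"
    using pre_nonempty pre_places pre_transition assms unfolding touching_def by fastforce
  then have cl: "closed A"
    using post_transition by (auto simp: closed_def)
  have F: "{#p \<in># M. p \<in> A#} = M" if "set_mset M \<subseteq> places N" for M
    using that assms by (subst filter_mset_eq_conv) auto
  have "{#p \<in># pre N t. p \<in> A#} = pre N t" "{#p \<in># post N t. p \<in> A#} = post N t"
    "{#p \<in># init N. p \<in> A#} = init N" for t
    using pre_places post_places init_places by (simp_all add: F subset_iff)
  then show ?thesis
    using assms by (intro net.equality) (auto simp: slice_net_simps[OF cl] T fun_eq_iff)
qed

section \<open>A slice as a local controller\<close>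

context
  fixes r
  assumes r: "r \<in># init N"
begin

lemmas slice_simps = slice_net_simps[OF slice_closed[OF r]]

lemma size_pre_slice:
  assumes "t \<in> touching (slice r)"
  shows "size {#p \<in># pre N t. p \<in> slice r#} = 1"
proof -
  have "{#p \<in># pre N t. p \<in> slice r#} \<noteq> {#}"
    using assms by (auto simp: touching_def filter_mset_eq_mempty_iff)
  then have "size {#p \<in># pre N t. p \<in> slice r#} \<noteq> 0"
    by simp
  then show ?thesis
    using size_pre_slice_le_1[OF r, of t] by linarith
qed

lemma petri_net_slice: "petri_net (slice_net (slice r))"
proof -
  have "{#p \<in># pre N t. p \<in> slice r#} \<noteq> {#} \<and> {#p \<in># post N t. p \<in> slice r#} \<noteq> {#}"
    if "t \<in> touching (slice r)" for t
    using size_pre_slice[OF that] size_filter_slice[OF r, of t]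
    by (metis size_empty zero_neq_one)
  moreover have "{#p \<in># pre N t. p \<in> slice r#} = {#} \<and> {#p \<in># post N t. p \<in> slice r#} = {#}"
    if "t \<notin> touching (slice r)" for t
    using that slice_closed[OF r] unfolding closed_def touching_def
    by (auto simp: filter_mset_eq_mempty_iff)
  ultimately show ?thesis
    unfolding petri_net_def slice_simps using pre_places post_places init_places by auto
qed

text \<open>Arcs, and hence paths and conflicts, of the slice are among those of
  \<open>N\<close>.\<close>

lemma occurrence_net_slice: "occurrence_net (slice_net (slice r))"
proof -
  let ?K = "slice_net (slice r)"
  have arcs: "arcs ?K \<subseteq> arcs N"
    using pre_transition post_transition by (auto simp: arcs_def slice_simps)
  then have rtrancl: "(arcs ?K)\<^sup>* \<subseteq> (arcs N)\<^sup>*"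
    by (rule rtrancl_mono)
  have wf: "wf (arcs ?K)"
    using wf_arcs arcs by (rule wf_subset)
  have "conflict N x y" if "conflict ?K x y" for x y
    using that arcs rtrancl unfolding conflict_def slice_simps by blast
  then have conflict: "\<not> conflict ?K (Inr t) (Inr t)" if "t \<in> touching (slice r)" for t
    using that no_self_conflict pre_transition unfolding touching_def by blast
  \<comment> \<open>A slice place keeps its producer, so no place becomes initial by the
    restriction.\<close>
  have "t \<in> touching (slice r)" if "p \<in> slice r" "p \<in># post N t" for p t
    using that slice_closed[OF r] by (auto simp: closed_def)
  then have init: "count (init ?K) p = (if \<exists>t\<in>transitions ?K. p \<in># post ?K t then 0 else 1)"
    if "p \<in> places ?K" for p
    using that init_count[of p] by (auto simp: slice_simps)
  show ?thesis
    unfolding occurrence_net_def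
    using petri_net_slice wf conflict init producer_unique pre_count_le_1 post_count_le_1
    by (auto simp: slice_simps)
qed

text \<open>A slice on its own does not wait for tokens of other slices, so the invariant is
  established anew for its own firing rule.\<close>

lemma reachable_slice_size: "M \<in> reachable (slice_net (slice r)) \<Longrightarrow> size M = 1"
proof (induction rule: reachable.induct)
  case reachable_init
  then show ?case
    using reachable_size_slice[OF r reachable.reachable_init] by (simp add: slice_simps)
next
  case (reachable_fire M t)
  let ?K = "slice_net (slice r)"
  have t: "t \<in> touching (slice r)" "pre ?K t \<subseteq># M"
    using reachable_fire by (auto simp: enabled_def slice_simps)
  then have "size (M - pre ?K t + post ?K t) + size (pre ?K t) = size M + size (post ?K t)"
    using size_filter_fire[of "pre ?K t" M "\<lambda>_. True" "post ?K t"] by simp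
  then show ?case
    using reachable_fire.IH size_filter_slice[OF r, of t] by (simp add: slice_simps)
qed

text \<open>The labelling is in general only a weak homomorphism, because the slice omits places of
  the other participants. Safety holds because markings have one token.\<close>

lemma local_controller_slice:
  assumes "homomorphism N (underlying G) l"
  shows "local_controller G (slice_net (slice r), l)"
proof -
  let ?K = "slice_net (slice r)"
  have T: "t \<in> transitions N" if "t \<in> touching (slice r)" for t
    using that pre_transition by (auto simp: touching_def)
  have "image_mset (fst l) (pre ?K t) \<subseteq># pre (underlying G) (snd l t) \<and>
      image_mset (fst l) (post ?K t) \<subseteq># post (underlying G) (snd l t)"
    if "t \<in> touching (slice r)" for t
  proof -
    have "pre (underlying G) (snd l t) = image_mset (fst l) (pre N t)"
      "post (underlying G) (snd l t) = image_mset (fst l) (post N t)"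
      using assms T[OF that] by (auto simp: homomorphism_def)
    then show ?thesis
      by (simp add: slice_simps image_mset_subseteq_mono)
  qed
  then have "weak_homomorphism ?K (underlying G) l"
    using assms T by (auto simp: weak_homomorphism_def homomorphism_def maps_nodes_def slice_simps)
  moreover have "safe_net ?K"
    unfolding safe_net_def using reachable_slice_size by (metis count_le_size)
  moreover have "size (init ?K) = 1"
    using reachable_slice_size reachable.reachable_init by blast
  ultimately show ?thesis
    using petri_net_slice size_pre_slice size_filter_slice[OF r]
    by (simp add: local_controller_def slice_simps)
qed

end

end

section \<open>Distribution\<close>

lemma unfolding_of_self:
  assumes "occurrence_net N"
  shows "unfolding_of N (N, (id, id))"
proof -
  interpret occ_net N
    by unfold_locales (rule assms)
  have "\<exists>t'\<in>transitions N. pre N t' = mset_set C \<and> t' = t"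
    if "t \<in> transitions N" "mset_set C = pre N t" for t C
    using that by auto
  then show ?thesis
    using assms by (auto simp: unfolding_of_def initial_branching_process_def initial_map_def
        branching_process_def homomorphism_def maps_nodes_def)
qed

lemma unfolded_controller_of_self:
  assumes "occurrence_net (fst K)"
  shows "unfolded_controller_of K K"
  unfolding unfolded_controller_of_def
  using unfolding_of_self[OF assms] by (intro exI[of _ "(id, id)"]) simp

theorem lemma4p2:
  fixes G :: "('q, 'u) game"
    and U \<sigma> :: "('p, 't, 'q, 'u) labelled_net"
  assumes "petri_game G"
    and "one_environment_player G"
    and "concurrency_preserving (underlying G)"
    and "unfolding_of (underlying G) U"
    and "unfolded_strategy G U \<sigma>"
  shows "distributable G \<sigma>"
proof -
  obtain N l where \<sigma>: "\<sigma> = (N, l)"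
    by (cases \<sigma>)
  have "initial_branching_process (underlying G) (N, l)"
    using assms(5) by (simp add: unfolded_strategy_def subprocess_def \<sigma>)
  then have occ: "occurrence_net N" and hom: "homomorphism N (underlying G) l"
    and ini: "initial_map N (underlying G) l"
    by (auto simp: initial_branching_process_def branching_process_def)
  interpret occ_net N
    by unfold_locales (rule occ)
  define env where "env p \<longleftrightarrow> fst l p \<in> environment_places G" for p
  have env_iff: "fst l p \<in> system_places G \<longleftrightarrow> \<not> env p" if "p \<in> places N" for p
  proof -
    have "fst l p \<in> places (underlying G)"
      using that hom by (auto simp: homomorphism_def maps_nodes_def)
    then show ?thesis
      using assms(1) by (auto simp: petri_game_def env_def)
  qed
  have env_size: "size {#p \<in># M. env p#} = 1" if "M \<in> reachable N" for M
  proof -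
    have "size {#p \<in># image_mset (fst l) M. p \<in> environment_places G#} = 1"
      using reachable_image_homomorphism[OF hom ini that] assms(2)
      unfolding one_environment_player_def by blast
    then show ?thesis
      unfolding filter_mset_image_mset size_image_mset env_def .
  qed
  have ex: "\<exists>f. bij_betw f (set_mset (post N t)) (set_mset (pre N t)) \<and>
      (\<forall>p\<in>set_mset (post N t). env (f p) \<longleftrightarrow> env p)" if t: "t \<in> transitions N" for t
  proof (rule exists_bij_betw_respecting)
    obtain M where M: "M \<in> reachable N" "enabled N M t"
      using firable[OF t] by blast
    then have sub: "pre N t \<subseteq># M"
      by (simp add: enabled_def)
    \<comment> \<open>Both markings are reachable and so have one environment token; hence
      \<open>t\<close> produces as many of them as it consumes.\<close>
    have "size {#p \<in># M - pre N t + post N t. env p#} = size {#p \<in># M. env p#}"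
      using env_size M reachable_fire by metis
    then have "size {#p \<in># post N t. env p#} = size {#p \<in># pre N t. env p#}"
      using size_filter_fire[OF sub, of env "post N t"] by linarith
    then show "card {p \<in> set_mset (post N t). env p} = card {p \<in> set_mset (pre N t). env p}"
      by (simp add: size_filter_pre size_filter_post)
    have "snd l t \<in> transitions (underlying G)"
      "image_mset (fst l) (pre N t) = pre (underlying G) (snd l t)"
      "image_mset (fst l) (post N t) = post (underlying G) (snd l t)"
      using hom t by (auto simp: homomorphism_def maps_nodes_def)
    then have "size (post N t) = size (pre N t)"
      using assms(3) unfolding concurrency_preserving_def by (metis size_image_mset)
    then show "card (set_mset (post N t)) = card (set_mset (pre N t))"
      by (metis mset_pre mset_post size_mset_set)
  qed auto
  \<comment> \<open>The choice matters only for transitions of \<open>N\<close>, since all others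
    have no output places.\<close>
  define origin where "origin t = (SOME f. bij_betw f (set_mset (post N t)) (set_mset (pre N t)) \<and>
      (\<forall>p\<in>set_mset (post N t). env (f p) \<longleftrightarrow> env p))" for t
  have origin_bij: "bij_betw (origin t) (set_mset (post N t)) (set_mset (pre N t))"
    and origin_env: "\<forall>p\<in>set_mset (post N t). env (origin t p) \<longleftrightarrow> env p" if "t \<in> transitions N" for t
    using someI_ex[OF ex[OF that]] by (auto simp: origin_def)
  interpret traced_net N origin
    by unfold_locales (rule origin_bij)
  \<comment> \<open>Each bijection respects owners, so a whole slice belongs to one kind of
    player.\<close>
  have env_slice: "env p \<longleftrightarrow> env r" if "p \<in> slice r" for p r
    using that by induction (use origin_env post_transition in auto)
  define K where "K r = (slice_net (slice r), l)" for r
  have occ_K: "occurrence_net (fst (K r))" and local_K: "local_controller G (K r)"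
    if "r \<in># init N" for r
    using occurrence_net_slice[OF that] local_controller_slice[OF that hom] by (simp_all add: K_def)
  have places_K: "places (fst (K r)) = places N \<inter> slice r" for r
    by (simp add: K_def slice_net_def restrict_net_def)
  \<comment> \<open>\<open>e\<close> is the only initial environment place; its slice becomes the
    environment controller, and the slices of the remaining initial places \<open>rs\<close> the
    system controllers.\<close>
  obtain e where e: "{#p \<in># init N. env p#} = {#e#}"
    using env_size[OF reachable_init] size_1_singleton_mset by blast
  have env_init: "p \<in># init N \<and> env p \<longleftrightarrow> p = e" for p
    using arg_cong[OF e, of "\<lambda>M. p \<in># M"] by simp
  then have e_init: "e \<in># init N" and env_e: "env e"
    by blast+
  obtain rs where rs: "set rs = set_mset (init N) - {e}" "distinct rs"
    using finite_distinct_list[of "set_mset (init N) - {e}"] by auto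
  have comp: "composable (K r) (K r')" if "r \<in># init N" "r' \<in># init N" "r \<noteq> r'" for r r'
    using slice_disjoint[OF that] unfolding composable_def places_K by (auto simp: K_def)
  have "sorted_wrt composable (map K xs)" if "set xs \<subseteq> set_mset (init N)" "distinct xs" for xs
    using that by (induction xs) (auto intro!: comp)
  from this[of "e # rs"] have sorted: "sorted_wrt composable (K e # map K rs)"
    using rs e_init by auto
  have env_K: "environment_controller G (K e)"
    using local_K[OF e_init] env_slice env_e
    unfolding environment_controller_def places_K by (auto simp: env_def K_def)
  have sys_K: "system_controller G (K r)" if "r \<in> set rs" for r
  proof -
    have "r \<in># init N" "\<not> env r"
      using that rs env_init by blast+
    then show ?thesis
      using local_K env_slice env_iff
      unfolding system_controller_def places_K by (auto simp: K_def)
  qed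
  have par_K: "foldl par (K e) (map K rs) = (N, l)"
  proof -
    have "foldl par (K e) (map K rs) = (slice_net (slice e \<union> (\<Union>r\<in>set rs. slice r)), l)"
      unfolding K_def using rs slice_closed e_init by (intro foldl_par_slice_nets) auto
    moreover have "slice e \<union> (\<Union>r\<in>set rs. slice r) = (\<Union>r\<in>set_mset (init N). slice r)"
      using rs e_init by auto
    ultimately show ?thesis
      using slice_net_eq[OF places_subset_slices] by simp
  qed
  \<comment> \<open>The composition is \<open>N\<close> itself, so the identity is the
    isomorphism.\<close>
  have iso: "isomorphic_labelled (reachable_part N, l) \<sigma>"
    unfolding isomorphic_labelled_def reachable_part_eq \<sigma>
    by (intro exI[of _ "(id, id)"])
      (auto simp: isomorphism_def homomorphism_def maps_nodes_def initial_map_def)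
  show ?thesis
    unfolding distributable_def Let_def
  proof (rule exI[of _ "K e"], rule exI[of _ "map K rs"], intro conjI ballI)
    show "\<exists>C :: ('p, 't, 'q, 'u) labelled_net.
        environment_controller G C \<and> unfolded_controller_of C (K e)"
      using env_K unfolded_controller_of_self[OF occ_K[OF e_init]] by blast
    show "\<exists>C :: ('p, 't, 'q, 'u) labelled_net.
        system_controller G C \<and> unfolded_controller_of C S" if S: "S \<in> set (map K rs)" for S
    proof -
      obtain r where "S = K r" "r \<in> set rs" "r \<in># init N"
        using S rs by auto
      then show ?thesis
        using sys_K unfolded_controller_of_self[OF occ_K] by blast
    qed
  qed (use sorted par_K iso in simp_all)
qed

end
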